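(* Let $R$ be a commutative ring with $1\neq0$ and let $S$ be a multiplicative set of $R$. If $R_S$ is a Mittag--Leffler $R$-module, then for every finitely generated $R$-module $L$ and every family of submodules $(N_\lambda)_{\lambda\in\Lambda}$ of $L$, $\bigl(\bigcap_{\lambda\in\Lambda}N_\lambda\bigr)_S=\bigcap_{\lambda\in\Lambda}(N_\lambda)_S$ inside $L_S$. In particular, $S$ is strongly multiplicative.
   Context: A multiplicative set $S$ of $R$ is a subset with $0\notin S$, $1\in S$, and $st\in S$ for all $s,t\in S$. It is strongly multiplicative if $\bigl(\bigcap_{i\in\Delta}s_iR\bigr)\cap S\neq\varnothing$ for every family $(s_i)_{i\in\Delta}$ of elements of $S$. $R_S$ and $L_S$ denote localizations at $S$. An $R$-module $M$ is Mittag--Leffler if for every family $\{Q_i\}_{i\in I}$ of $R$-modules the canonical map $M\otimes_R\prod_{i\in I}Q_i\to\prod_{i\in I}(M\otimes_RQ_i)$ is injective. *)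

theory Defs
  imports "HOL-Algebra.Algebra"
begin

text \<open>Modules over a commutative ring are those of HOL-Algebra.  Their records extend ring
  records, so every module carries \<open>mult\<close> and \<open>one\<close> fields which the locale \<open>module\<close> ignores.\<close>

definition regular_module :: "('r, 'z) ring_scheme \<Rightarrow> ('r, 'r) module" where
  "regular_module R =
     \<lparr>carrier = carrier R, monoid.mult = monoid.mult R, monoid.one = \<one>\<^bsub>R\<^esub>,
      ring.zero = \<zero>\<^bsub>R\<^esub>, ring.add = ring.add R, smult = monoid.mult R\<rparr>"

lemma module_regular_module:
  assumes "cring R"
  shows "module R (regular_module R)"
proof -
  interpret R: cring R by fact
  have ag: "abelian_group (regular_module R)"
    by (rule abelian_groupI) (auto simp: regular_module_def R.a_ac intro: bexI[of _ "\<ominus>\<^bsub>R\<^esub> _"] R.l_neg)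
  show ?thesis
    by (rule moduleI[OF assms ag]) (auto simp: regular_module_def R.l_distr R.r_distr R.m_assoc)
qed

definition finitely_generated_module ::
    "('r, 'z) ring_scheme \<Rightarrow> ('r, 'l, 'y) module_scheme \<Rightarrow> bool" where
  "finitely_generated_module R L \<longleftrightarrow>
     module R L \<and>
     (\<exists>A \<subseteq> carrier L. finite A \<and>
        (\<forall>x \<in> carrier L. \<exists>a \<in> A \<rightarrow> carrier R. x = (\<Oplus>\<^bsub>L\<^esub>v\<in>A. a v \<odot>\<^bsub>L\<^esub> v)))"

definition multiplicative_set :: "('r, 'z) ring_scheme \<Rightarrow> 'r set \<Rightarrow> bool" where
  "multiplicative_set R S \<longleftrightarrow> submonoid S R \<and> \<zero>\<^bsub>R\<^esub> \<notin> S"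

text \<open>The type argument is the type of the indices of the families.  The intersection of the
  empty family of ideals is the whole ring.\<close>

definition strongly_multiplicative_set ::
    "'d itself \<Rightarrow> ('r, 'z) ring_scheme \<Rightarrow> 'r set \<Rightarrow> bool" where
  "strongly_multiplicative_set (_ :: 'd itself) R S \<longleftrightarrow>
     multiplicative_set R S \<and>
     (\<forall>(\<Delta> :: 'd set) s. s \<in> \<Delta> \<rightarrow> S \<longrightarrow>
        (carrier R \<inter> (\<Inter>i\<in>\<Delta>. PIdl\<^bsub>R\<^esub> (s i))) \<inter> S \<noteq> {})"


section \<open>Localization\<close>

definition loc_rel ::
    "'r set \<Rightarrow> ('r, 'l, 'y) module_scheme \<Rightarrow> (('l \<times> 'r) \<times> ('l \<times> 'r)) set" where
  "loc_rel S L =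
     {((x, s), (y, t)). x \<in> carrier L \<and> s \<in> S \<and> y \<in> carrier L \<and> t \<in> S \<and>
        (\<exists>u\<in>S. u \<odot>\<^bsub>L\<^esub> (t \<odot>\<^bsub>L\<^esub> x \<ominus>\<^bsub>L\<^esub> s \<odot>\<^bsub>L\<^esub> y) = \<zero>\<^bsub>L\<^esub>)}"

definition loc_frac :: "'r set \<Rightarrow> ('r, 'l, 'y) module_scheme \<Rightarrow> 'l \<Rightarrow> 'r \<Rightarrow> ('l \<times> 'r) set" where
  "loc_frac S L x s = loc_rel S L `` {(x, s)}"

text \<open>The localization \<open>L\<^sub>S\<close>, as an \<open>R\<close>-module.  The fields \<open>mult\<close> and \<open>one\<close> are only
  meaningful when \<open>L\<close> is an algebra; for \<open>L = regular_module R\<close> they are those of the ring \<open>R\<^sub>S\<close>.\<close>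

definition localization ::
    "('r, 'z) ring_scheme \<Rightarrow> 'r set \<Rightarrow> ('r, 'l, 'y) module_scheme \<Rightarrow> ('r, ('l \<times> 'r) set) module" where
  "localization R S L =
     \<lparr>carrier = (carrier L \<times> S) // loc_rel S L,
      monoid.mult = (\<lambda>A B. \<Union>(x, s)\<in>A. \<Union>(y, t)\<in>B. loc_frac S L (x \<otimes>\<^bsub>L\<^esub> y) (s \<otimes>\<^bsub>R\<^esub> t)),
      monoid.one = loc_frac S L \<one>\<^bsub>L\<^esub> \<one>\<^bsub>R\<^esub>,
      ring.zero = loc_frac S L \<zero>\<^bsub>L\<^esub> \<one>\<^bsub>R\<^esub>,
      ring.add = (\<lambda>A B. \<Union>(x, s)\<in>A. \<Union>(y, t)\<in>B. loc_frac S L (t \<odot>\<^bsub>L\<^esub> x \<oplus>\<^bsub>L\<^esub> s \<odot>\<^bsub>L\<^esub> y) (s \<otimes>\<^bsub>R\<^esub> t)),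
      smult = (\<lambda>r A. \<Union>(x, s)\<in>A. loc_frac S L (r \<odot>\<^bsub>L\<^esub> x) s)\<rparr>"

text \<open>For a submodule \<open>N\<close> of \<open>L\<close>, the localization \<open>N\<^sub>S\<close> viewed inside \<open>L\<^sub>S\<close>, i.e. the image
  of the canonical (injective) map from \<open>N\<^sub>S\<close> to \<open>L\<^sub>S\<close>.\<close>

definition localized_submodule ::
    "'r set \<Rightarrow> ('r, 'l, 'y) module_scheme \<Rightarrow> 'l set \<Rightarrow> ('l \<times> 'r) set set" where
  "localized_submodule S L N = (\<lambda>(x, s). loc_frac S L x s) ` (N \<times> S)"

lemma loc_rel_iff:
  assumes "cring R" "multiplicative_set R S" "module R L"
  shows "((x, s), (y, t)) \<in> loc_rel S L \<longleftrightarrow>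
    x \<in> carrier L \<and> s \<in> S \<and> y \<in> carrier L \<and> t \<in> S \<and>
    (\<exists>u\<in>S. (u \<otimes>\<^bsub>R\<^esub> t) \<odot>\<^bsub>L\<^esub> x = (u \<otimes>\<^bsub>R\<^esub> s) \<odot>\<^bsub>L\<^esub> y)"
proof -
  interpret R: cring R by fact
  interpret L: module R L by fact
  have S: "S \<subseteq> carrier R"
    using assms(2) by (simp add: multiplicative_set_def submonoid_def)
  have "u \<odot>\<^bsub>L\<^esub> (t \<odot>\<^bsub>L\<^esub> x \<ominus>\<^bsub>L\<^esub> s \<odot>\<^bsub>L\<^esub> y) = \<zero>\<^bsub>L\<^esub> \<longleftrightarrow>
        (u \<otimes>\<^bsub>R\<^esub> t) \<odot>\<^bsub>L\<^esub> x = (u \<otimes>\<^bsub>R\<^esub> s) \<odot>\<^bsub>L\<^esub> y"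
    if xy: "x \<in> carrier L" "y \<in> carrier L" and c: "s \<in> carrier R" "t \<in> carrier R" "u \<in> carrier R" for u
  proof -
    have "u \<odot>\<^bsub>L\<^esub> (t \<odot>\<^bsub>L\<^esub> x \<ominus>\<^bsub>L\<^esub> s \<odot>\<^bsub>L\<^esub> y) = (u \<otimes>\<^bsub>R\<^esub> t) \<odot>\<^bsub>L\<^esub> x \<ominus>\<^bsub>L\<^esub> (u \<otimes>\<^bsub>R\<^esub> s) \<odot>\<^bsub>L\<^esub> y"
      using that by (simp add: a_minus_def L.smult_r_distr L.smult_r_minus L.smult_assoc1)
    moreover have "a \<ominus>\<^bsub>L\<^esub> b = \<zero>\<^bsub>L\<^esub> \<longleftrightarrow> a = b" if "a \<in> carrier L" "b \<in> carrier L" for a b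
      using that by (metis L.add.inv_closed L.minus_equality L.minus_minus L.r_neg a_minus_def L.a_comm)
    ultimately show ?thesis using that by simp
  qed
  then show ?thesis
    using S unfolding loc_rel_def by blast
qed

lemma equiv_frac_rel:
  assumes "cring R" "multiplicative_set R S" "module R L"
  shows "equiv (carrier L \<times> S) (loc_rel S L)"
proof (rule equivI)
  interpret R: cring R by fact
  interpret L: module R L by fact
  interpret S: submonoid S R using assms(2) by (simp add: multiplicative_set_def)
  note iff = loc_rel_iff[OF assms]
  show "loc_rel S L \<subseteq> (carrier L \<times> S) \<times> (carrier L \<times> S)"
    by (auto simp: iff)
  show "refl_on (carrier L \<times> S) (loc_rel S L)"
    by (auto simp: refl_on_def iff)
  show "sym (loc_rel S L)"
    unfolding sym_def by (auto simp: iff) (metis)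
  show "trans (loc_rel S L)"
  proof (rule transI)
    fix a b c assume "(a, b) \<in> loc_rel S L" "(b, c) \<in> loc_rel S L"
    then obtain x s y t z r u v where e: "a = (x, s)" "b = (y, t)" "c = (z, r)"
      and c: "x \<in> carrier L" "y \<in> carrier L" "z \<in> carrier L"
      and d: "s \<in> S" "t \<in> S" "r \<in> S" "u \<in> S" "v \<in> S"
      and u: "(u \<otimes>\<^bsub>R\<^esub> t) \<odot>\<^bsub>L\<^esub> x = (u \<otimes>\<^bsub>R\<^esub> s) \<odot>\<^bsub>L\<^esub> y"
      and v: "(v \<otimes>\<^bsub>R\<^esub> r) \<odot>\<^bsub>L\<^esub> y = (v \<otimes>\<^bsub>R\<^esub> t) \<odot>\<^bsub>L\<^esub> z"
      by (cases a; cases b; cases c) (auto simp: iff)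
    have "((u \<otimes>\<^bsub>R\<^esub> v \<otimes>\<^bsub>R\<^esub> t) \<otimes>\<^bsub>R\<^esub> r) \<odot>\<^bsub>L\<^esub> x = (v \<otimes>\<^bsub>R\<^esub> r) \<odot>\<^bsub>L\<^esub> ((u \<otimes>\<^bsub>R\<^esub> t) \<odot>\<^bsub>L\<^esub> x)"
      using c d by (simp add: R.m_ac flip: L.smult_assoc1)
    also have "\<dots> = (u \<otimes>\<^bsub>R\<^esub> s) \<odot>\<^bsub>L\<^esub> ((v \<otimes>\<^bsub>R\<^esub> r) \<odot>\<^bsub>L\<^esub> y)"
      unfolding u using c d by (simp add: R.m_ac flip: L.smult_assoc1)
    also have "\<dots> = ((u \<otimes>\<^bsub>R\<^esub> v \<otimes>\<^bsub>R\<^esub> t) \<otimes>\<^bsub>R\<^esub> s) \<odot>\<^bsub>L\<^esub> z"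
      unfolding v using c d by (simp add: R.m_ac flip: L.smult_assoc1)
    finally show "(a, c) \<in> loc_rel S L"
      using c d by (auto simp: e iff intro!: bexI[of _ "u \<otimes>\<^bsub>R\<^esub> v \<otimes>\<^bsub>R\<^esub> t"])
  qed
qed

lemma add_frac:
  assumes "cring R" "multiplicative_set R S" "module R L"
    and "x \<in> carrier L" "y \<in> carrier L" "s \<in> S" "t \<in> S"
  shows "loc_frac S L x s \<oplus>\<^bsub>localization R S L\<^esub> loc_frac S L y t =
           loc_frac S L (t \<odot>\<^bsub>L\<^esub> x \<oplus>\<^bsub>L\<^esub> s \<odot>\<^bsub>L\<^esub> y) (s \<otimes>\<^bsub>R\<^esub> t)"
proof -
  interpret R: cring R by fact
  interpret L: module R L by fact
  interpret S: submonoid S R using assms(2) by (simp add: multiplicative_set_def)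
  note iff = loc_rel_iff[OF assms(1-3)]
  note eq = equiv_frac_rel[OF assms(1-3)]
  have "congruent2 (loc_rel S L) (loc_rel S L)
     (\<lambda>(x, s) (y, t). loc_frac S L (t \<odot>\<^bsub>L\<^esub> x \<oplus>\<^bsub>L\<^esub> s \<odot>\<^bsub>L\<^esub> y) (s \<otimes>\<^bsub>R\<^esub> t))"
  proof (rule congruent2_commuteI[OF eq])
    show "(case a of (x, s) \<Rightarrow> \<lambda>(y, t). loc_frac S L (t \<odot>\<^bsub>L\<^esub> x \<oplus>\<^bsub>L\<^esub> s \<odot>\<^bsub>L\<^esub> y) (s \<otimes>\<^bsub>R\<^esub> t)) b =
          (case b of (x, s) \<Rightarrow> \<lambda>(y, t). loc_frac S L (t \<odot>\<^bsub>L\<^esub> x \<oplus>\<^bsub>L\<^esub> s \<odot>\<^bsub>L\<^esub> y) (s \<otimes>\<^bsub>R\<^esub> t)) a"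
      if "a \<in> carrier L \<times> S" "b \<in> carrier L \<times> S" for a b
      using that by (auto simp: L.a_comm R.m_comm)
  next
    fix a b c assume a: "a \<in> carrier L \<times> S" and bc: "(b, c) \<in> loc_rel S L"
    obtain z r where z: "a = (z, r)" "z \<in> carrier L" "r \<in> S" using a by auto
    obtain x s y t u where e: "b = (x, s)" "c = (y, t)"
      and c: "x \<in> carrier L" "y \<in> carrier L"
      and d: "s \<in> S" "t \<in> S" "u \<in> S"
      and u: "(u \<otimes>\<^bsub>R\<^esub> t) \<odot>\<^bsub>L\<^esub> x = (u \<otimes>\<^bsub>R\<^esub> s) \<odot>\<^bsub>L\<^esub> y"
      using bc by (cases b; cases c) (auto simp: iff)
    have "(u \<otimes>\<^bsub>R\<^esub> (r \<otimes>\<^bsub>R\<^esub> t)) \<odot>\<^bsub>L\<^esub> (r \<odot>\<^bsub>L\<^esub> x) = (r \<otimes>\<^bsub>R\<^esub> r) \<odot>\<^bsub>L\<^esub> ((u \<otimes>\<^bsub>R\<^esub> t) \<odot>\<^bsub>L\<^esub> x)"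
      using c d z by (simp add: R.m_ac flip: L.smult_assoc1)
    also have "\<dots> = (u \<otimes>\<^bsub>R\<^esub> (r \<otimes>\<^bsub>R\<^esub> s)) \<odot>\<^bsub>L\<^esub> (r \<odot>\<^bsub>L\<^esub> y)"
      unfolding u using c d z by (simp add: R.m_ac flip: L.smult_assoc1)
    finally have "(u \<otimes>\<^bsub>R\<^esub> (r \<otimes>\<^bsub>R\<^esub> t)) \<odot>\<^bsub>L\<^esub> (s \<odot>\<^bsub>L\<^esub> z \<oplus>\<^bsub>L\<^esub> r \<odot>\<^bsub>L\<^esub> x) =
        (u \<otimes>\<^bsub>R\<^esub> (r \<otimes>\<^bsub>R\<^esub> s)) \<odot>\<^bsub>L\<^esub> (t \<odot>\<^bsub>L\<^esub> z \<oplus>\<^bsub>L\<^esub> r \<odot>\<^bsub>L\<^esub> y)"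
      using c d z by (simp add: L.smult_r_distr R.m_ac flip: L.smult_assoc1)
    then have "((s \<odot>\<^bsub>L\<^esub> z \<oplus>\<^bsub>L\<^esub> r \<odot>\<^bsub>L\<^esub> x, r \<otimes>\<^bsub>R\<^esub> s), (t \<odot>\<^bsub>L\<^esub> z \<oplus>\<^bsub>L\<^esub> r \<odot>\<^bsub>L\<^esub> y, r \<otimes>\<^bsub>R\<^esub> t)) \<in> loc_rel S L"
      using c d z by (auto simp: iff)
    then show "(case a of (x, s) \<Rightarrow> \<lambda>(y, t). loc_frac S L (t \<odot>\<^bsub>L\<^esub> x \<oplus>\<^bsub>L\<^esub> s \<odot>\<^bsub>L\<^esub> y) (s \<otimes>\<^bsub>R\<^esub> t)) b =
          (case a of (x, s) \<Rightarrow> \<lambda>(y, t). loc_frac S L (t \<odot>\<^bsub>L\<^esub> x \<oplus>\<^bsub>L\<^esub> s \<odot>\<^bsub>L\<^esub> y) (s \<otimes>\<^bsub>R\<^esub> t)) c"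
      using equiv_class_eq[OF eq] by (simp add: z e loc_frac_def)
  qed
  from UN_equiv_class2[OF eq eq this, of "(x, s)" "(y, t)"] assms
  show ?thesis by (simp add: localization_def loc_frac_def case_prod_unfold)
qed

lemma smult_frac:
  assumes "cring R" "multiplicative_set R S" "module R L"
    and "r \<in> carrier R" "x \<in> carrier L" "s \<in> S"
  shows "r \<odot>\<^bsub>localization R S L\<^esub> loc_frac S L x s = loc_frac S L (r \<odot>\<^bsub>L\<^esub> x) s"
proof -
  interpret R: cring R by fact
  interpret L: module R L by fact
  interpret S: submonoid S R using assms(2) by (simp add: multiplicative_set_def)
  note iff = loc_rel_iff[OF assms(1-3)]
  note eq = equiv_frac_rel[OF assms(1-3)]
  have "congruent (loc_rel S L) (\<lambda>(x, s). loc_frac S L (r \<odot>\<^bsub>L\<^esub> x) s)"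
  proof (rule congruentI)
    fix b c assume bc: "(b, c) \<in> loc_rel S L"
    obtain x s y t u where e: "b = (x, s)" "c = (y, t)"
      and c: "x \<in> carrier L" "y \<in> carrier L"
      and d: "s \<in> S" "t \<in> S" "u \<in> S"
      and u: "(u \<otimes>\<^bsub>R\<^esub> t) \<odot>\<^bsub>L\<^esub> x = (u \<otimes>\<^bsub>R\<^esub> s) \<odot>\<^bsub>L\<^esub> y"
      using bc by (cases b; cases c) (auto simp: iff)
    have "(u \<otimes>\<^bsub>R\<^esub> t) \<odot>\<^bsub>L\<^esub> (r \<odot>\<^bsub>L\<^esub> x) = r \<odot>\<^bsub>L\<^esub> ((u \<otimes>\<^bsub>R\<^esub> t) \<odot>\<^bsub>L\<^esub> x)"
      using c d assms(4) by (simp add: R.m_ac flip: L.smult_assoc1)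
    also have "\<dots> = (u \<otimes>\<^bsub>R\<^esub> s) \<odot>\<^bsub>L\<^esub> (r \<odot>\<^bsub>L\<^esub> y)"
      unfolding u using c d assms(4) by (simp add: R.m_ac flip: L.smult_assoc1)
    finally have "((r \<odot>\<^bsub>L\<^esub> x, s), (r \<odot>\<^bsub>L\<^esub> y, t)) \<in> loc_rel S L"
      using c d assms(4) by (auto simp: iff)
    then show "(case b of (x, s) \<Rightarrow> loc_frac S L (r \<odot>\<^bsub>L\<^esub> x) s) = (case c of (x, s) \<Rightarrow> loc_frac S L (r \<odot>\<^bsub>L\<^esub> x) s)"
      using equiv_class_eq[OF eq] by (simp add: e loc_frac_def)
  qed
  from UN_equiv_class[OF eq this, of "(x, s)"] assms
  show ?thesis by (simp add: localization_def loc_frac_def case_prod_unfold)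
qed

lemma carrier_localization:
  "carrier (localization R S L) = localized_submodule S L (carrier L)"
  by (auto simp: localization_def localized_submodule_def loc_frac_def quotient_def)

lemma module_localization:
  assumes "cring R" "multiplicative_set R S" "module R L"
  shows "module R (localization R S L)"
proof -
  interpret R: cring R by fact
  interpret L: module R L by fact
  interpret S: submonoid S R using assms(2) by (simp add: multiplicative_set_def)
  let ?Q = "localization R S L"
  note iff = loc_rel_iff[OF assms]
  note add = add_frac[OF assms] and sm = smult_frac[OF assms]
  have zero: "\<zero>\<^bsub>?Q\<^esub> = loc_frac S L \<zero>\<^bsub>L\<^esub> \<one>\<^bsub>R\<^esub>" by (simp add: localization_def)
  have cI: "loc_frac S L x s \<in> carrier ?Q" if "x \<in> carrier L" "s \<in> S" for x s
    using that by (auto simp: carrier_localization localized_submodule_def)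
  have cE: "\<exists>x\<in>carrier L. \<exists>s\<in>S. a = loc_frac S L x s" if "a \<in> carrier ?Q" for a
    using that by (auto simp: carrier_localization localized_submodule_def)
  have eqI: "loc_frac S L x s = loc_frac S L y t"
    if "x \<in> carrier L" "s \<in> S" "y \<in> carrier L" "t \<in> S" "t \<odot>\<^bsub>L\<^esub> x = s \<odot>\<^bsub>L\<^esub> y" for x s y t
    unfolding loc_frac_def by (rule equiv_class_eq[OF equiv_frac_rel[OF assms]])
      (use that in \<open>auto simp: iff intro!: bexI[of _ "\<one>\<^bsub>R\<^esub>"]\<close>)
  note ac = L.smult_r_distr L.smult_l_distr L.a_ac R.m_ac L.smult_assoc1[symmetric]
  show ?thesis
  proof (rule moduleI)
    show "abelian_group ?Q"
    proof (rule abelian_groupI)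
      show "a \<oplus>\<^bsub>?Q\<^esub> b \<in> carrier ?Q" if "a \<in> carrier ?Q" "b \<in> carrier ?Q" for a b
        using cE[OF that(1)] cE[OF that(2)] by (auto simp: add intro!: cI)
      show "\<zero>\<^bsub>?Q\<^esub> \<in> carrier ?Q" by (auto simp: zero intro!: cI)
      show "a \<oplus>\<^bsub>?Q\<^esub> b \<oplus>\<^bsub>?Q\<^esub> c = a \<oplus>\<^bsub>?Q\<^esub> (b \<oplus>\<^bsub>?Q\<^esub> c)"
        if "a \<in> carrier ?Q" "b \<in> carrier ?Q" "c \<in> carrier ?Q" for a b c
        using cE[OF that(1)] cE[OF that(2)] cE[OF that(3)] by (auto simp: add ac intro!: eqI)
      show "a \<oplus>\<^bsub>?Q\<^esub> b = b \<oplus>\<^bsub>?Q\<^esub> a" if "a \<in> carrier ?Q" "b \<in> carrier ?Q" for a b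
        using cE[OF that(1)] cE[OF that(2)] by (auto simp: add ac)
      show "\<zero>\<^bsub>?Q\<^esub> \<oplus>\<^bsub>?Q\<^esub> a = a" if "a \<in> carrier ?Q" for a
        using cE[OF that] by (auto simp: add zero)
      show "\<exists>b\<in>carrier ?Q. b \<oplus>\<^bsub>?Q\<^esub> a = \<zero>\<^bsub>?Q\<^esub>" if a': "a \<in> carrier ?Q" for a
      proof -
        obtain x s where a: "a = loc_frac S L x s" "x \<in> carrier L" "s \<in> S" using cE[OF a'] by blast
        have "loc_frac S L (\<ominus>\<^bsub>L\<^esub> x) s \<oplus>\<^bsub>?Q\<^esub> a = \<zero>\<^bsub>?Q\<^esub>"
          using a(2,3) eqI[of "\<zero>\<^bsub>L\<^esub>" "s \<otimes>\<^bsub>R\<^esub> s" "\<zero>\<^bsub>L\<^esub>" "\<one>\<^bsub>R\<^esub>"] by (simp add: a(1) add zero L.smult_r_minus L.l_neg)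
        then show ?thesis using cI[of "\<ominus>\<^bsub>L\<^esub> x" s] a by auto
      qed
    qed
    show "a \<odot>\<^bsub>?Q\<^esub> b \<in> carrier ?Q" if "a \<in> carrier R" "b \<in> carrier ?Q" for a b
      using cE[OF that(2)] that(1) by (auto simp: sm intro!: cI)
    show "(a \<oplus>\<^bsub>R\<^esub> b) \<odot>\<^bsub>?Q\<^esub> c = a \<odot>\<^bsub>?Q\<^esub> c \<oplus>\<^bsub>?Q\<^esub> b \<odot>\<^bsub>?Q\<^esub> c"
      if "a \<in> carrier R" "b \<in> carrier R" "c \<in> carrier ?Q" for a b c
    proof -
      note H = that
      obtain x s where c: "c = loc_frac S L x s" "x \<in> carrier L" "s \<in> S" using cE[OF H(3)] by blast
      show ?thesis using c(2,3) that(1,2)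
        by (simp add: c(1) sm add, intro eqI) (auto simp: ac R.l_distr R.r_distr)
    qed
    show "a \<odot>\<^bsub>?Q\<^esub> (b \<oplus>\<^bsub>?Q\<^esub> c) = a \<odot>\<^bsub>?Q\<^esub> b \<oplus>\<^bsub>?Q\<^esub> a \<odot>\<^bsub>?Q\<^esub> c"
      if "a \<in> carrier R" "b \<in> carrier ?Q" "c \<in> carrier ?Q" for a b c
    proof -
      note H = that
      obtain x s where b: "b = loc_frac S L x s" "x \<in> carrier L" "s \<in> S" using cE[OF H(2)] by blast
      obtain y t where c: "c = loc_frac S L y t" "y \<in> carrier L" "t \<in> S" using cE[OF H(3)] by blast
      show ?thesis using b(2,3) c(2,3) that(1)
        by (simp add: b(1) c(1) sm add, intro eqI) (auto simp: ac)
    qed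
    show "(a \<otimes>\<^bsub>R\<^esub> b) \<odot>\<^bsub>?Q\<^esub> c = a \<odot>\<^bsub>?Q\<^esub> (b \<odot>\<^bsub>?Q\<^esub> c)"
      if "a \<in> carrier R" "b \<in> carrier R" "c \<in> carrier ?Q" for a b c
      using cE[OF that(3)] that(1,2) by (auto simp: sm L.smult_assoc1)
    show "\<one>\<^bsub>R\<^esub> \<odot>\<^bsub>?Q\<^esub> a = a" if "a \<in> carrier ?Q" for a
      using cE[OF that] by (auto simp: sm)
  qed (rule assms(1))
qed


section \<open>Mittag-Leffler modules\<close>

definition product_module ::
    "'i set \<Rightarrow> ('i \<Rightarrow> ('r, 'q, 'y) module_scheme) \<Rightarrow> ('r, 'i \<Rightarrow> 'q) module" where
  "product_module I Q =
     \<lparr>carrier = (\<Pi>\<^sub>E i\<in>I. carrier (Q i)),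
      monoid.mult = (\<lambda>x y. \<lambda>i\<in>I. x i \<otimes>\<^bsub>Q i\<^esub> y i),
      monoid.one = (\<lambda>i\<in>I. \<one>\<^bsub>Q i\<^esub>),
      ring.zero = (\<lambda>i\<in>I. \<zero>\<^bsub>Q i\<^esub>),
      ring.add = (\<lambda>x y. \<lambda>i\<in>I. x i \<oplus>\<^bsub>Q i\<^esub> y i),
      smult = (\<lambda>r x. \<lambda>i\<in>I. r \<odot>\<^bsub>Q i\<^esub> x i)\<rparr>"

lemma module_product_module:
  assumes "cring R" and "\<And>i. i \<in> I \<Longrightarrow> module R (Q i)"
  shows "module R (product_module I Q)"
proof -
  interpret R: cring R by fact
  have ag: "abelian_group (Q i)" if "i \<in> I" for i
    using assms(2)[OF that] by (rule module.axioms)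
  note mon = abelian_group.axioms(1)[OF ag]
  show ?thesis
  proof (rule moduleI)
    show "abelian_group (product_module I Q)"
    proof (rule abelian_groupI)
      fix x assume x: "x \<in> carrier (product_module I Q)"
      let ?y = "\<lambda>i\<in>I. \<ominus>\<^bsub>Q i\<^esub> x i"
      have "?y \<in> carrier (product_module I Q)" "?y \<oplus>\<^bsub>product_module I Q\<^esub> x = \<zero>\<^bsub>product_module I Q\<^esub>"
        using x ag by (auto simp: product_module_def PiE_iff abelian_group.a_inv_closed abelian_group.l_neg
            intro!: restrict_ext)
      then show "\<exists>y\<in>carrier (product_module I Q). y \<oplus>\<^bsub>product_module I Q\<^esub> x = \<zero>\<^bsub>product_module I Q\<^esub>"
        by blast
    qed (auto simp: product_module_def PiE_iff extensional_def fun_eq_iff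
        abelian_monoid.a_closed[OF mon] abelian_monoid.zero_closed[OF mon]
        abelian_monoid.a_assoc[OF mon] abelian_monoid.a_comm[OF mon]
        abelian_monoid.a_lcomm[OF mon] abelian_monoid.l_zero[OF mon] abelian_monoid.r_zero[OF mon])
  qed (auto simp: product_module_def PiE_iff extensional_def fun_eq_iff R.is_cring
      module.smult_closed[OF assms(2)] module.smult_l_distr[OF assms(2)]
      module.smult_r_distr[OF assms(2)] module.smult_assoc1[OF assms(2)] module.smult_one[OF assms(2)])
qed

inductive_set tensor_relators ::
    "('r, 'z) ring_scheme \<Rightarrow> ('r, 'a, 'x) module_scheme \<Rightarrow> ('r, 'b, 'y) module_scheme
       \<Rightarrow> ('a \<times> 'b \<Rightarrow>\<^sub>0 int) set"
  for R M N where
    left: "\<lbrakk>m \<in> carrier M; m' \<in> carrier M; n \<in> carrier N\<rbrakk> \<Longrightarrow>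
      frag_of (m \<oplus>\<^bsub>M\<^esub> m', n) - frag_of (m, n) - frag_of (m', n) \<in> tensor_relators R M N"
  | right: "\<lbrakk>m \<in> carrier M; n \<in> carrier N; n' \<in> carrier N\<rbrakk> \<Longrightarrow>
      frag_of (m, n \<oplus>\<^bsub>N\<^esub> n') - frag_of (m, n) - frag_of (m, n') \<in> tensor_relators R M N"
  | balanced: "\<lbrakk>r \<in> carrier R; m \<in> carrier M; n \<in> carrier N\<rbrakk> \<Longrightarrow>
      frag_of (r \<odot>\<^bsub>M\<^esub> m, n) - frag_of (m, r \<odot>\<^bsub>N\<^esub> n) \<in> tensor_relators R M N"

definition tensor_kernel ::
    "('r, 'z) ring_scheme \<Rightarrow> ('r, 'a, 'x) module_scheme \<Rightarrow> ('r, 'b, 'y) module_scheme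
       \<Rightarrow> ('a \<times> 'b \<Rightarrow>\<^sub>0 int) set" where
  "tensor_kernel R M N =
     generate (free_Abelian_group (carrier M \<times> carrier N)) (tensor_relators R M N)"

text \<open>The additive group of the tensor product over \<open>R\<close>, in multiplicative notation.  Its scalar
  multiplication is not needed: injectivity of an \<open>R\<close>-linear map concerns the underlying groups.\<close>

definition tensor_product ::
    "('r, 'z) ring_scheme \<Rightarrow> ('r, 'a, 'x) module_scheme \<Rightarrow> ('r, 'b, 'y) module_scheme
       \<Rightarrow> ('a \<times> 'b \<Rightarrow>\<^sub>0 int) set monoid" where
  "tensor_product R M N =
     free_Abelian_group (carrier M \<times> carrier N) Mod tensor_kernel R M N"

text \<open>The class of a formal sum of pairs; in particular \<open>m \<otimes> n\<close> is the class of \<open>frag_of (m, n)\<close>.\<close>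

definition tensor_class ::
    "('r, 'z) ring_scheme \<Rightarrow> ('r, 'a, 'x) module_scheme \<Rightarrow> ('r, 'b, 'y) module_scheme
       \<Rightarrow> ('a \<times> 'b \<Rightarrow>\<^sub>0 int) \<Rightarrow> ('a \<times> 'b \<Rightarrow>\<^sub>0 int) set" where
  "tensor_class R M N c =
     tensor_kernel R M N #>\<^bsub>free_Abelian_group (carrier M \<times> carrier N)\<^esub> c"

text \<open>The canonical map sending \<open>m \<otimes> q\<close> to the family of the \<open>m \<otimes> q\<^sub>i\<close>: on formal sums it is
  given by \<open>frag_extend\<close>, and it descends to cosets (see \<open>canonical_map_class\<close>).\<close>

definition tensor_product_canonical_map ::
    "('r, 'z) ring_scheme \<Rightarrow> ('r, 'a, 'x) module_scheme \<Rightarrow> 'i set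
       \<Rightarrow> ('i \<Rightarrow> ('r, 'q, 'y) module_scheme)
       \<Rightarrow> ('a \<times> ('i \<Rightarrow> 'q) \<Rightarrow>\<^sub>0 int) set \<Rightarrow> 'i \<Rightarrow> ('a \<times> 'q \<Rightarrow>\<^sub>0 int) set" where
  "tensor_product_canonical_map R M I Q C =
     the_elem ((\<lambda>c. \<lambda>i\<in>I. tensor_class R M (Q i) (frag_extend (\<lambda>(m, q). frag_of (m, q i)) c)) ` C)"

lemma tensor_relators_subset:
  assumes "module R M" "module R N"
  shows "tensor_relators R M N \<subseteq> carrier (free_Abelian_group (carrier M \<times> carrier N))"
proof -
  interpret M: module R M by fact
  interpret N: module R N by fact
  show ?thesis
  proof
    fix c assume "c \<in> tensor_relators R M N"
    then have "Poly_Mapping.keys c \<subseteq> carrier M \<times> carrier N"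
      by cases (auto dest!: keys_diff[THEN subsetD])
    then show "c \<in> carrier (free_Abelian_group (carrier M \<times> carrier N))"
      by simp
  qed
qed

lemma tensor_kernel_subgroup:
  assumes "module R M" "module R N"
  shows "subgroup (tensor_kernel R M N) (free_Abelian_group (carrier M \<times> carrier N))"
  unfolding tensor_kernel_def
  by (rule group.generate_is_subgroup[OF group_free_Abelian_group tensor_relators_subset[OF assms]])

lemma comm_group_tensor_product:
  assumes "module R M" "module R N"
  shows "comm_group (tensor_product R M N)"
  unfolding tensor_product_def
  by (rule comm_group.abelian_FactGroup[OF abelian_free_Abelian_group tensor_kernel_subgroup[OF assms]])

lemma tensor_class_eq_iff:
  assumes "module R M" "module R N"
    and "c \<in> carrier (free_Abelian_group (carrier M \<times> carrier N))"
    and "d \<in> carrier (free_Abelian_group (carrier M \<times> carrier N))"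
  shows "tensor_class R M N c = tensor_class R M N d \<longleftrightarrow> c - d \<in> tensor_kernel R M N"
proof -
  let ?F = "free_Abelian_group (carrier M \<times> carrier N)"
  interpret F: comm_group ?F by (rule abelian_free_Abelian_group)
  note K = tensor_kernel_subgroup[OF assms(1,2)]
  have "tensor_class R M N c = tensor_class R M N d \<longleftrightarrow> c \<otimes>\<^bsub>?F\<^esub> inv\<^bsub>?F\<^esub> d \<in> tensor_kernel R M N"
    unfolding tensor_class_def
    using F.repr_independence[OF _ _ K] F.rcos_self[OF _ K] subgroup.rcos_module[OF K F.is_group] assms(3,4)
    by (metis)
  also have "c \<otimes>\<^bsub>?F\<^esub> inv\<^bsub>?F\<^esub> d = c - d"
    using assms(4) by simp
  finally show ?thesis .
qed

lemma frag_extend_tensor_kernel: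
  assumes M: "module R M" and Q: "\<And>i. i \<in> I \<Longrightarrow> module R (Q i)" and i: "i \<in> I"
    and c: "c \<in> tensor_kernel R M (product_module I Q)"
  shows "frag_extend (\<lambda>(m, q). frag_of (m, q i)) c \<in> tensor_kernel R M (Q i)"
proof -
  let ?f = "frag_extend (\<lambda>(m, q). frag_of (m, q i))"
  let ?P = "free_Abelian_group (carrier M \<times> carrier (product_module I Q))"
  let ?F = "free_Abelian_group (carrier M \<times> carrier (Q i))"
  have K: "subgroup (tensor_kernel R M (Q i)) ?F"
    by (rule tensor_kernel_subgroup[OF M Q[OF i]])
  have neg: "- x \<in> tensor_kernel R M (Q i)" if "x \<in> tensor_kernel R M (Q i)" for x
    using subgroup.m_inv_closed[OF K that] subgroup.mem_carrier[OF K that] by simp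
  have rel: "?f h \<in> tensor_kernel R M (Q i)"
    if "h \<in> tensor_relators R M (product_module I Q)" for h
  proof -
    have "?f h \<in> tensor_relators R M (Q i)"
      using that i
      by cases (auto simp: product_module_def frag_extend_diff PiE_iff intro!: tensor_relators.intros)
    then show ?thesis unfolding tensor_kernel_def by (rule generate.incl)
  qed
  have P: "Poly_Mapping.keys h \<subseteq> carrier M \<times> carrier (product_module I Q)"
    if "h \<in> tensor_relators R M (product_module I Q)" for h
    using that module_product_module[OF module.axioms(1)[OF M] Q] tensor_relators_subset[OF M] by fastforce
  show ?thesis
    using c unfolding tensor_kernel_def[of R M "product_module I Q"]
  proof (induction rule: generate.induct)
    case one
    then show ?case using subgroup.one_closed[OF K] by simp
  next
    case (incl h)
    then show ?case by (rule rel)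
  next
    case (inv h)
    then show ?case using neg[OF rel[OF inv]] P[OF inv] by (simp add: frag_extend_minus)
  next
    case (eng h1 h2)
    then show ?case using subgroup.m_closed[OF K] by (simp add: frag_extend_add)
  qed
qed

lemma canonical_map_class:
  assumes M: "module R M" and Q: "\<And>i. i \<in> I \<Longrightarrow> module R (Q i)"
    and c: "c \<in> carrier (free_Abelian_group (carrier M \<times> carrier (product_module I Q)))"
  shows "tensor_product_canonical_map R M I Q (tensor_class R M (product_module I Q) c) =
           (\<lambda>i\<in>I. tensor_class R M (Q i) (frag_extend (\<lambda>(m, q). frag_of (m, q i)) c))"
proof -
  let ?P = "free_Abelian_group (carrier M \<times> carrier (product_module I Q))"
  let ?g = "\<lambda>c. \<lambda>i\<in>I. tensor_class R M (Q i) (frag_extend (\<lambda>(m, q). frag_of (m, q i)) c)"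
  interpret P: comm_group ?P by (rule abelian_free_Abelian_group)
  have mod: "module R (product_module I Q)"
    by (rule module_product_module[OF module.axioms(1)[OF M] Q])
  note K = tensor_kernel_subgroup[OF M mod]
  have carr: "frag_extend (\<lambda>(m, q). frag_of (m, q i)) d \<in> carrier (free_Abelian_group (carrier M \<times> carrier (Q i)))"
    if "d \<in> carrier ?P" "i \<in> I" for d i
  proof -
    have "Poly_Mapping.keys (frag_extend (\<lambda>(m, q). frag_of (m, q i)) d)
            \<subseteq> (\<Union>x\<in>Poly_Mapping.keys d. Poly_Mapping.keys (case x of (m, q) \<Rightarrow> frag_of (m, q i)))"
      by (rule keys_frag_extend)
    also have "\<dots> \<subseteq> carrier M \<times> carrier (Q i)"
      using that by (fastforce simp: product_module_def PiE_iff split: prod.splits)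
    finally show ?thesis by simp
  qed
  have "?g d = ?g c" if d: "d \<in> tensor_class R M (product_module I Q) c" for d
  proof (rule restrict_ext)
    fix i assume i: "i \<in> I"
    obtain k where k: "k \<in> tensor_kernel R M (product_module I Q)" "d = k + c"
      using d by (auto simp: tensor_class_def r_coset_def)
    have "k \<in> carrier ?P" using subgroup.mem_carrier[OF K k(1)] .
    then have "d \<in> carrier ?P" using P.m_closed[OF _ c, of k] k(2) by simp
    moreover have "frag_extend (\<lambda>(m, q). frag_of (m, q i)) d - frag_extend (\<lambda>(m, q). frag_of (m, q i)) c
        = frag_extend (\<lambda>(m, q). frag_of (m, q i)) k"
      by (simp add: k(2) frag_extend_add)
    ultimately show "tensor_class R M (Q i) (frag_extend (\<lambda>(m, q). frag_of (m, q i)) d) =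
        tensor_class R M (Q i) (frag_extend (\<lambda>(m, q). frag_of (m, q i)) c)"
      using tensor_class_eq_iff[OF M Q[OF i] carr carr] i c
        frag_extend_tensor_kernel[OF M Q i k(1)] by simp
  qed
  moreover have "c \<in> tensor_class R M (product_module I Q) c"
    unfolding tensor_class_def by (rule P.rcos_self[OF c K])
  ultimately have "?g ` tensor_class R M (product_module I Q) c = {?g c}"
    by blast
  then show ?thesis
    unfolding tensor_product_canonical_map_def by simp
qed

text \<open>HOL cannot quantify over all types inside a definition, so the Mittag-Leffler condition is
  relative to a type \<open>'i\<close> of indices and a type \<open>'q\<close> containing the carriers of the modules.
  It is the full condition when \<open>'i\<close> and \<open>'q\<close> are both \<open>(nat \<Rightarrow> 'r) set\<close>.  Indeed, let
  \<open>\<Sum>\<^sub>k m\<^sub>k \<otimes> (q\<^sub>k\<^sub>i)\<^sub>i\<close> be in the kernel of the canonical map for an arbitrary family of modules.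
  For each index, finitely many elements suffice to derive the relation \<open>\<Sum>\<^sub>k m\<^sub>k \<otimes> q\<^sub>k\<^sub>i = 0\<close>, so
  \<open>Q\<^sub>i\<close> may be replaced by a finitely generated submodule, hence by a quotient \<open>R\<^sup>n / K\<close>, whose
  elements are subsets of \<open>R\<^sup>n\<close>; and two indices for which \<open>n\<close>, \<open>K\<close> and the finite tuple
  \<open>(q\<^sub>k\<^sub>i)\<^sub>k\<close> agree may be identified, which leaves at most as many indices as there are
  elements of \<open>(nat \<Rightarrow> 'r) set\<close>.\<close>

definition mittag_leffler ::
    "'i itself \<Rightarrow> 'q itself \<Rightarrow> ('r, 'z) ring_scheme \<Rightarrow> ('r, 'a, 'x) module_scheme \<Rightarrow> bool" where
  "mittag_leffler (_ :: 'i itself) (_ :: 'q itself) R M \<longleftrightarrow>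
     (\<forall>(I :: 'i set) (Q :: 'i \<Rightarrow> ('r, 'q) module). (\<forall>i\<in>I. module R (Q i)) \<longrightarrow>
        inj_on (tensor_product_canonical_map R M I Q)
               (carrier (tensor_product R M (product_module I Q))))"

end

theory Submission
  imports Defs
begin

text \<open>Let \<open>\<I>\<close> be a set of ideals that all meet \<open>S\<close>, and let \<open>P\<close> be the product of the modules \<open>R/I\<close>
  for \<open>I \<in> \<I>\<close>.  Each tensor \<open>1 \<otimes> 1\<close> in \<open>R\<^sub>S \<otimes> R/I\<close> vanishes, so by injectivity of the
  canonical map \<open>1 \<otimes> (1)\<^sub>I\<close> vanishes in \<open>R\<^sub>S \<otimes> P\<close>.  Under the map from \<open>R\<^sub>S \<otimes> P\<close> to
  \<open>P\<^sub>S\<close> this says that some \<open>u \<in> S\<close> annihilates \<open>(1)\<^sub>I\<close>, that is, \<open>u\<close> lies in every member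
  of \<open>\<I>\<close>.  The first claim follows with the ideals \<open>(N\<^sub>k : x)\<close>, where \<open>x/s\<close> lies in all the
  \<open>(N\<^sub>k)\<^sub>S\<close>, and the second one with the principal ideals of the given elements of \<open>S\<close>.\<close>

section \<open>Quotients of the ring as coded modules\<close>

definition restrict_scalars :: "('r \<Rightarrow> 't) \<Rightarrow> ('t, 'z) ring_scheme \<Rightarrow> ('r, 't) module" where
  "restrict_scalars h T =
     \<lparr>carrier = carrier T, monoid.mult = monoid.mult T, monoid.one = \<one>\<^bsub>T\<^esub>,
      ring.zero = \<zero>\<^bsub>T\<^esub>, ring.add = ring.add T, smult = (\<lambda>r x. h r \<otimes>\<^bsub>T\<^esub> x)\<rparr>"

lemma module_restrict_scalars:
  assumes "cring R" "ring T" and h: "h \<in> ring_hom R T"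
  shows "module R (restrict_scalars h T)"
proof -
  interpret R: cring R by fact
  interpret T: ring T by fact
  have ag: "abelian_group (restrict_scalars h T)"
    by (rule abelian_groupI)
      (auto simp: restrict_scalars_def T.a_ac intro: bexI[of _ "\<ominus>\<^bsub>T\<^esub> _"] T.l_neg)
  show ?thesis
    by (rule moduleI[OF assms(1) ag])
      (use h in \<open>auto simp: restrict_scalars_def ring_hom_closed[OF h] ring_hom_add[OF h]
         ring_hom_mult[OF h] ring_hom_one[OF h] T.l_distr T.r_distr T.m_assoc\<close>)
qed

text \<open>Codes the cosets of an ideal of \<open>R\<close>, which are subsets of \<open>R\<close>, in the type over which
  \<open>mittag_leffler\<close> quantifies; ideals are coded in the same way to serve as indices.\<close>

definition cylinder :: "'r set \<Rightarrow> (nat \<Rightarrow> 'r) set" where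
  "cylinder A = {f. f 0 \<in> A}"

lemma cylinder_eq_iff [simp]: "cylinder A = cylinder B \<longleftrightarrow> A = B"
proof
  \<comment> \<open>Evaluation at 0 sends \<open>cylinder A\<close> onto \<open>A\<close>: a
    constant sequence lies over each element.\<close>
  have "A = (\<lambda>f. f 0) ` cylinder A" for A :: "'r set"
    by (auto simp: cylinder_def image_iff intro!: exI[of _ "\<lambda>_. _"])
  then show "A = B" if "cylinder A = cylinder B"
    using that by metis
qed simp

text \<open>Since \<open>cylinder\<close> is injective, the fibres of the map are the cosets of
  \<open>I\<close>. This compatibility lets \<open>image_ring\<close> transport the ring operations
  to the codes.\<close>

lemma weak_ring_morphism_cylinder:
  assumes "ideal I R"
  shows "weak_ring_morphism (\<lambda>a. cylinder (I +>\<^bsub>R\<^esub> a)) I R"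
proof -
  interpret I: ideal I R by fact
  show ?thesis
    by (rule weak_ring_morphismI[OF assms]) (simp add: I.quotient_eq_iff_same_a_r_cos[OF assms])
qed

text \<open>A copy of \<open>R/I\<close> on codes of cosets. The ring fields are kept so that the
  class of 1 is available as the unit of the record.\<close>

definition coded_quotient :: "('r, 'z) ring_scheme \<Rightarrow> 'r set \<Rightarrow> ('r, (nat \<Rightarrow> 'r) set) module" where
  "coded_quotient R I =
     (let f = \<lambda>a. cylinder (I +>\<^bsub>R\<^esub> a) in restrict_scalars f (image_ring f R))"

lemma module_coded_quotient:
  assumes "cring R" "ideal I R"
  shows "module R (coded_quotient R I)"
  unfolding coded_quotient_def Let_def
  using ring.image_ring_is_ring[OF _ weak_ring_morphism_cylinder[OF assms(2)]]
    ring.weak_ring_morphism_is_hom[OF _ weak_ring_morphism_cylinder[OF assms(2)]] assms(1)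
  by (auto intro!: module_restrict_scalars simp: cring.axioms(1))

lemma one_coded_quotient_closed:
  assumes "cring R"
  shows "\<one>\<^bsub>coded_quotient R I\<^esub> \<in> carrier (coded_quotient R I)"
proof -
  interpret R: cring R by fact
  show ?thesis
    by (simp add: coded_quotient_def Let_def restrict_scalars_def image_ring_carrier image_ring_one)
qed

text \<open>Acting on the unit by \<open>r\<close> gives the class of \<open>r\<close>, and the
  kernel of the coset map is \<open>I\<close>. Thus the annihilator of the unit recovers the
  ideal.\<close>

lemma smult_one_coded_quotient_eq_zero_iff:
  assumes "cring R" and I: "ideal I R" and r: "r \<in> carrier R"
  shows "r \<odot>\<^bsub>coded_quotient R I\<^esub> \<one>\<^bsub>coded_quotient R I\<^esub> = \<zero>\<^bsub>coded_quotient R I\<^esub> \<longleftrightarrow> r \<in> I"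
proof -
  interpret R: cring R by fact
  let ?f = "\<lambda>a. cylinder (I +>\<^bsub>R\<^esub> a)"
  note f = weak_ring_morphism_cylinder[OF I]
  have "?f \<in> ring_hom R (image_ring ?f R)"
    by (rule R.weak_ring_morphism_is_hom[OF f])
  from ring_hom_mult[OF this r R.one_closed] ring_hom_one[OF this]
  have "?f r \<otimes>\<^bsub>image_ring ?f R\<^esub> \<one>\<^bsub>image_ring ?f R\<^esub> = ?f r"
    using r by simp
  moreover have "?f r = \<zero>\<^bsub>image_ring ?f R\<^esub> \<longleftrightarrow> r \<in> I"
    using R.weak_ring_morphism_ker[OF f] r ideal.Icarr[OF I] by (auto simp: a_kernel_def')
  ultimately show ?thesis
    by (simp add: coded_quotient_def Let_def restrict_scalars_def)
qed

section \<open>From tensors to fractions\<close>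

text \<open>The biadditive map \<open>(a/s, p) \<mapsto> (a p)/s\<close>, which induces \<open>R\<^sub>S \<otimes> P \<rightarrow> P\<^sub>S\<close>.\<close>

definition frac_action :: "'r set \<Rightarrow> ('r, 'p, 'y) module_scheme \<Rightarrow> ('r \<times> 'r) set \<Rightarrow> 'p \<Rightarrow> ('p \<times> 'r) set" where
  "frac_action S P A p = (\<Union>(a, s)\<in>A. loc_frac S P (a \<odot>\<^bsub>P\<^esub> p) s)"

text \<open>Independence of the representative: a relation \<open>u t x = u s y\<close> in
  \<open>R\<close> becomes the relation required in \<open>P\<^sub>S\<close> after acting on
  \<open>p\<close>.\<close>

lemma frac_action_frac:
  assumes "cring R" "multiplicative_set R S" "module R P"
    and a: "a \<in> carrier R" and s: "s \<in> S" and p: "p \<in> carrier P"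
  shows "frac_action S P (loc_frac S (regular_module R) a s) p = loc_frac S P (a \<odot>\<^bsub>P\<^esub> p) s"
proof -
  interpret R: cring R by fact
  interpret P: module R P by fact
  interpret S: submonoid S R using assms(2) by (simp add: multiplicative_set_def)
  note M = module_regular_module[OF assms(1)]
  note iffR = loc_rel_iff[OF assms(1,2) M] and iffP = loc_rel_iff[OF assms(1-3)]
  have "congruent (loc_rel S (regular_module R)) (\<lambda>(a, s). loc_frac S P (a \<odot>\<^bsub>P\<^esub> p) s)"
  proof (rule congruentI)
    fix b c assume "(b, c) \<in> loc_rel S (regular_module R)"
    then obtain x s y t u where e: "b = (x, s)" "c = (y, t)"
      and c: "x \<in> carrier R" "y \<in> carrier R" "s \<in> S" "t \<in> S" "u \<in> S"
      and u: "u \<otimes>\<^bsub>R\<^esub> t \<otimes>\<^bsub>R\<^esub> x = u \<otimes>\<^bsub>R\<^esub> s \<otimes>\<^bsub>R\<^esub> y"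
      by (cases b; cases c) (auto simp: iffR, auto simp: regular_module_def)
    have "(u \<otimes>\<^bsub>R\<^esub> t) \<odot>\<^bsub>P\<^esub> (x \<odot>\<^bsub>P\<^esub> p) = (u \<otimes>\<^bsub>R\<^esub> s) \<odot>\<^bsub>P\<^esub> (y \<odot>\<^bsub>P\<^esub> p)"
      using c p by (simp add: u flip: P.smult_assoc1)
    then have "((x \<odot>\<^bsub>P\<^esub> p, s), (y \<odot>\<^bsub>P\<^esub> p, t)) \<in> loc_rel S P"
      using c p by (auto simp: iffP)
    then show "(case b of (a, s) \<Rightarrow> loc_frac S P (a \<odot>\<^bsub>P\<^esub> p) s) = (case c of (a, s) \<Rightarrow> loc_frac S P (a \<odot>\<^bsub>P\<^esub> p) s)"
      using equiv_class_eq[OF equiv_frac_rel[OF assms(1-3)]] by (simp add: e loc_frac_def)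
  qed
  from UN_equiv_class[OF equiv_frac_rel[OF assms(1,2) M] this, of "(a, s)"] a s
  show ?thesis by (simp add: frac_action_def loc_frac_def case_prod_unfold regular_module_def)
qed

lemma localization_fracE:
  assumes "A \<in> carrier (localization R S L)"
  obtains x s where "x \<in> carrier L" "s \<in> S" "A = loc_frac S L x s"
  using assms by (auto simp: carrier_localization localized_submodule_def)

lemma loc_frac_closed:
  assumes "x \<in> carrier L" "s \<in> S"
  shows "loc_frac S L x s \<in> carrier (localization R S L)"
  using assms by (auto simp: carrier_localization localized_submodule_def)

lemma loc_frac_eq_iff:
  assumes "cring R" "multiplicative_set R S" "module R L"
    and "x \<in> carrier L" "s \<in> S" "y \<in> carrier L" "t \<in> S"
  shows "loc_frac S L x s = loc_frac S L y t \<longleftrightarrow>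
    (\<exists>u\<in>S. (u \<otimes>\<^bsub>R\<^esub> t) \<odot>\<^bsub>L\<^esub> x = (u \<otimes>\<^bsub>R\<^esub> s) \<odot>\<^bsub>L\<^esub> y)"
  using eq_equiv_class_iff[OF equiv_frac_rel[OF assms(1-3)], of "(x, s)" "(y, t)"] assms
  by (simp add: loc_frac_def loc_rel_iff[OF assms(1-3)])

text \<open>The action on fractions extends to a homomorphism from the free abelian group to
  \<open>P\<^sub>S\<close> that kills the tensor kernel. Hence \<open>(a p)/s\<close> is zero in
  \<open>P\<^sub>S\<close>, which means that some element of \<open>S\<close> annihilates
  \<open>a p\<close>.\<close>

lemma frac_tensor_eq_zeroD:
  fixes P :: "('r, 'p, 'y) module_scheme"
  assumes "cring R" "multiplicative_set R S" "module R P"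
    and a: "a \<in> carrier R" and s: "s \<in> S" and p: "p \<in> carrier P"
    and ker: "frag_of (loc_frac S (regular_module R) a s, p)
      \<in> tensor_kernel R (localization R S (regular_module R)) P"
  shows "\<exists>u\<in>S. (u \<otimes>\<^bsub>R\<^esub> a) \<odot>\<^bsub>P\<^esub> p = \<zero>\<^bsub>P\<^esub>"
proof -
  interpret R: cring R by fact
  interpret P: module R P by fact
  interpret S: submonoid S R using assms(2) by (simp add: multiplicative_set_def)
  let ?L = "regular_module R" and ?PS = "localization R S P"
  let ?RS = "localization R S ?L"
  let ?F = "free_Abelian_group (carrier ?RS \<times> carrier P)"
  note M = module_regular_module[OF assms(1)]
  note modRS = module_localization[OF assms(1,2) M] and modPS = module_localization[OF assms(1-3)]
  interpret RS: module R ?RS by (rule modRS)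
  interpret PS: module R ?PS by (rule modPS)
  note act = frac_action_frac[OF assms(1-3)]
  note eq = loc_frac_eq_iff[OF assms(1-3)]
  have L: "carrier ?L = carrier R" "add ?L = add R" "smult ?L = monoid.mult R"
    by (simp_all add: regular_module_def)
  have cE: thesis if "A \<in> carrier ?RS" "\<And>x s. \<lbrakk>x \<in> carrier R; s \<in> S; A = loc_frac S ?L x s\<rbrakk> \<Longrightarrow> thesis"
    for A thesis using that localization_fracE[OF that(1)] by (metis L(1))
  have cl: "frac_action S P A q \<in> carrier ?PS" if "A \<in> carrier ?RS" "q \<in> carrier P" for A q
    using that by (elim cE) (auto simp: act intro!: loc_frac_closed)
  have "(\<lambda>(A, q). frac_action S P A q) ` (carrier ?RS \<times> carrier P) \<subseteq> carrier ?PS"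
    using cl by auto
  then obtain h where h: "h \<in> hom ?F (add_monoid ?PS)"
    and "\<And>z. z \<in> carrier ?RS \<times> carrier P \<Longrightarrow> h (frag_of z) = (\<lambda>(A, q). frac_action S P A q) z"
    by (rule PS.add.free_Abelian_group_universal) blast
  then have hf: "h (frag_of (A, q)) = frac_action S P A q"
    if "A \<in> carrier ?RS" "q \<in> carrier P" for A q
    using that by simp
  interpret h: group_hom ?F "add_monoid ?PS" h
    using h by (simp add: group_hom_def group_hom_axioms_def PS.add.is_group)
  \<comment> \<open>Every relator is a difference, so killing it amounts to comparing two values of
    \<open>h\<close>.\<close>
  have h_diff: "h (c - d) = \<zero>\<^bsub>?PS\<^esub> \<longleftrightarrow> h c = h d" if "c \<in> carrier ?F" "d \<in> carrier ?F" for c d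
  proof -
    have "h c = h ((c - d) + d)" by simp
    also have "\<dots> = h (c - d) \<oplus>\<^bsub>?PS\<^esub> h d"
      using h.hom_mult[of "c - d" d] that subsetD[OF keys_diff] by fastforce
    finally have *: "h c = h (c - d) \<oplus>\<^bsub>?PS\<^esub> h d" .
    have "h (c - d) \<in> carrier ?PS" "h d \<in> carrier ?PS"
      using h.hom_closed[of "c - d"] h.hom_closed[OF that(2)] that subsetD[OF keys_diff] by fastforce+
    then show ?thesis using * by (metis PS.add.r_cancel_one' PS.l_zero)
  qed
  have keys_pair: "Poly_Mapping.keys (frag_of v + frag_of w) \<subseteq> V" if "v \<in> V" "w \<in> V"
    for v w :: "('r \<times> 'r) set \<times> 'p" and V
    using keys_add[of "frag_of v" "frag_of w"] that by auto
  have h_add: "h (c + d) = h c \<oplus>\<^bsub>?PS\<^esub> h d" if "c \<in> carrier ?F" "d \<in> carrier ?F" for c d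
    using h.hom_mult[OF that] by simp
  have rel: "h c = \<zero>\<^bsub>?PS\<^esub>" if "c \<in> tensor_relators R ?RS P" for c
    using that
  proof cases
    case (left m m' n)
    obtain x s y t where m: "m = loc_frac S ?L x s" "m' = loc_frac S ?L y t"
      and c: "x \<in> carrier R" "s \<in> S" "y \<in> carrier R" "t \<in> S"
      using left(2,3) by (metis cE)
    have "frac_action S P (m \<oplus>\<^bsub>?RS\<^esub> m') n = frac_action S P m n \<oplus>\<^bsub>?PS\<^esub> frac_action S P m' n"
      using c left(4)
      by (simp add: m add_frac[OF assms(1,2) M] add_frac[OF assms(1-3)] act L P.smult_l_distr P.smult_assoc1)
    then show ?thesis
      using left by (simp add: diff_diff_eq h_diff h_add hf keys_pair)
  next
    case (right m n n')
    obtain x s where m: "m = loc_frac S ?L x s" and c: "x \<in> carrier R" "s \<in> S"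
      using right(2) by (metis cE)
    \<comment> \<open>The sum of two fractions over \<open>s\<close> is formed over
      \<open>s s\<close>; the numerator on the left has to be expanded accordingly.\<close>
    have "loc_frac S P (x \<odot>\<^bsub>P\<^esub> (n \<oplus>\<^bsub>P\<^esub> n')) s =
        loc_frac S P (s \<odot>\<^bsub>P\<^esub> (x \<odot>\<^bsub>P\<^esub> n) \<oplus>\<^bsub>P\<^esub> s \<odot>\<^bsub>P\<^esub> (x \<odot>\<^bsub>P\<^esub> n')) (s \<otimes>\<^bsub>R\<^esub> s)"
      using c right(3,4)
      by (subst eq) (auto simp: P.smult_r_distr R.m_ac simp flip: P.smult_assoc1)
    then have "frac_action S P m (n \<oplus>\<^bsub>P\<^esub> n') = frac_action S P m n \<oplus>\<^bsub>?PS\<^esub> frac_action S P m n'"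
      using c right(3,4) by (simp add: m add_frac[OF assms(1-3)] act)
    then show ?thesis
      using right by (simp add: diff_diff_eq h_diff h_add hf keys_pair)
  next
    case (balanced r m n)
    obtain x s where m: "m = loc_frac S ?L x s" and c: "x \<in> carrier R" "s \<in> S"
      using balanced(3) by (metis cE)
    have "frac_action S P (r \<odot>\<^bsub>?RS\<^esub> m) n = frac_action S P m (r \<odot>\<^bsub>P\<^esub> n)"
      using c balanced(2,4)
      by (simp add: m smult_frac[OF assms(1,2) M] act L R.m_comm[of r] P.smult_assoc1)
    then show ?thesis
      using balanced by (simp add: h_diff hf)
  qed
  have "h c = \<zero>\<^bsub>?PS\<^esub>" if "c \<in> tensor_kernel R ?RS P" for c
  proof -
    \<comment> \<open>The kernel of \<open>h\<close> is a subgroup containing the relators, hence it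
      contains the subgroup they generate.\<close>
    have "tensor_kernel R ?RS P \<subseteq> kernel ?F (add_monoid ?PS) h"
      unfolding tensor_kernel_def
      by (rule group.generate_subgroup_incl[OF group_free_Abelian_group _ h.subgroup_kernel])
        (use rel tensor_relators_subset[OF modRS assms(3)] in
          \<open>auto simp: kernel_def simp del: carrier_free_Abelian_group_iff\<close>)
    then show ?thesis using that by (auto simp: kernel_def)
  qed
  from this[OF ker] have "loc_frac S P (a \<odot>\<^bsub>P\<^esub> p) s = \<zero>\<^bsub>?PS\<^esub>"
    using a s p by (simp add: hf loc_frac_closed act L)
  \<comment> \<open>The zero of \<open>P\<^sub>S\<close> is the fraction 0/1, which is where the
    factor 1 comes from.\<close>
  then obtain u where "u \<in> S" "(u \<otimes>\<^bsub>R\<^esub> \<one>\<^bsub>R\<^esub>) \<odot>\<^bsub>P\<^esub> (a \<odot>\<^bsub>P\<^esub> p) = (u \<otimes>\<^bsub>R\<^esub> s) \<odot>\<^bsub>P\<^esub> \<zero>\<^bsub>P\<^esub>"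
    using a s p by (auto simp: localization_def eq)
  then show ?thesis
    using a s p by (auto simp: P.smult_assoc1)
qed

section \<open>A common element of ideals that meet the multiplicative set\<close>

text \<open>The factors are indexed by the codes of the ideals themselves, so the fixed index type
  serves every set of ideals, whatever family it came from.\<close>

lemma mittag_leffler_localization_ideals_meet:
  fixes R :: "('r, 'z) ring_scheme"
  assumes R: "cring R" and S: "multiplicative_set R S"
    and inj: "mittag_leffler TYPE((nat \<Rightarrow> 'r) set) TYPE((nat \<Rightarrow> 'r) set) R
      (localization R S (regular_module R))"
    and ideals: "\<And>I. I \<in> \<I> \<Longrightarrow> ideal I R" and meet: "\<And>I. I \<in> \<I> \<Longrightarrow> I \<inter> S \<noteq> {}"
  shows "\<exists>u\<in>S. \<forall>I\<in>\<I>. u \<in> I"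
proof -
  interpret R: cring R by fact
  interpret S: submonoid S R using S by (simp add: multiplicative_set_def)
  let ?RS = "localization R S (regular_module R)"
  \<comment> \<open>An index is decoded to its ideal. The inverse is meaningful only on codes, and
    \<open>J\<close> below consists of codes.\<close>
  define Q where "Q C = coded_quotient R (the_inv_into UNIV cylinder C)" for C :: "(nat \<Rightarrow> 'r) set"
  have "inj (cylinder :: 'r set \<Rightarrow> _)" by (simp add: inj_def)
  then have Q_cyl: "Q (cylinder I) = coded_quotient R I" for I
    by (simp add: Q_def the_inv_f_f)
  define J where "J = cylinder ` \<I>"
  define P where "P = product_module J Q"
  define e where "e = (\<lambda>C\<in>J. \<one>\<^bsub>Q C\<^esub>)"
  \<comment> \<open>The tensor of \<open>v\<close>, the fraction 1/1, with \<open>e\<close>, the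
    family of units, is the one to be shown zero.\<close>
  define v where "v = loc_frac S (regular_module R) \<one>\<^bsub>R\<^esub> \<one>\<^bsub>R\<^esub>"
  have Qmod: "module R (Q C)" if "C \<in> J" for C
    using that ideals by (auto simp: J_def Q_cyl intro!: module_coded_quotient[OF R])
  have Pmod: "module R P"
    unfolding P_def by (rule module_product_module[OF R Qmod])
  interpret P: module R P by (rule Pmod)
  note M = module_regular_module[OF R]
  note RSmod = module_localization[OF R S M]
  have e: "e \<in> carrier P"
    by (auto simp: e_def P_def product_module_def J_def Q_cyl one_coded_quotient_closed[OF R])
  have v: "v \<in> carrier ?RS"
    unfolding v_def by (intro loc_frac_closed) (auto simp: regular_module_def)
  let ?F = "free_Abelian_group (carrier ?RS \<times> carrier P)"
  have carr: "frag_of (v, e) \<in> carrier ?F" "0 \<in> carrier ?F" using e v by auto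
  have vanish: "frag_of (v, \<one>\<^bsub>Q C\<^esub>) \<in> tensor_kernel R ?RS (Q C)" if C: "C \<in> J" for C
  proof -
    obtain I where I: "I \<in> \<I>" "C = cylinder I" using C by (auto simp: J_def)
    obtain s where s: "s \<in> I" "s \<in> S" using meet[OF I(1)] by auto
    interpret Q: module R "Q C" by (rule Qmod[OF C])
    interpret RS: module R ?RS by (rule RSmod)
    let ?K = "tensor_kernel R ?RS (Q C)" and ?G = "free_Abelian_group (carrier ?RS \<times> carrier (Q C))"
    have K: "subgroup ?K ?G" by (rule tensor_kernel_subgroup[OF RSmod Qmod[OF C]])
    \<comment> \<open>As \<open>s\<close> annihilates the unit of \<open>Q C\<close> and
      \<open>s w = v\<close>, moving \<open>s\<close> across the tensor gives \<open>v\<close>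
      tensor 1 = \<open>w\<close> tensor 0.\<close>
    define w where "w = loc_frac S (regular_module R) \<one>\<^bsub>R\<^esub> s"
    have w: "w \<in> carrier ?RS"
      unfolding w_def using s by (intro loc_frac_closed) (auto simp: regular_module_def)
    have one: "\<one>\<^bsub>Q C\<^esub> \<in> carrier (Q C)"
      by (simp add: I Q_cyl one_coded_quotient_closed[OF R])
    have sw: "s \<odot>\<^bsub>?RS\<^esub> w = v"
      using s unfolding w_def v_def
      by (subst smult_frac[OF R S M]; simp add: regular_module_def[of R])
        (subst loc_frac_eq_iff[OF R S module_regular_module[OF R], unfolded regular_module_def]; auto)
    have "s \<odot>\<^bsub>Q C\<^esub> \<one>\<^bsub>Q C\<^esub> = \<zero>\<^bsub>Q C\<^esub>"
      using s smult_one_coded_quotient_eq_zero_iff[OF R ideals[OF I(1)], of s] by (simp add: I Q_cyl)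
    then have 1: "frag_of (v, \<one>\<^bsub>Q C\<^esub>) - frag_of (w, \<zero>\<^bsub>Q C\<^esub>) \<in> ?K"
      using tensor_relators.balanced[of s R w ?RS "\<one>\<^bsub>Q C\<^esub>" "Q C"] s w one
      unfolding tensor_kernel_def by (auto simp: sw intro: generate.incl)
    \<comment> \<open>The right additivity relator for 0 + 0 collapses to this negative.\<close>
    have "- frag_of (w, \<zero>\<^bsub>Q C\<^esub>) \<in> ?K"
      using tensor_relators.right[of w ?RS "\<zero>\<^bsub>Q C\<^esub>" "Q C" "\<zero>\<^bsub>Q C\<^esub>" R] w
      unfolding tensor_kernel_def by (auto intro: generate.incl)
    then have "frag_of (w, \<zero>\<^bsub>Q C\<^esub>) \<in> ?K"
      using subgroup.m_inv_closed[OF K] subgroup.mem_carrier[OF K] by fastforce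
    from subgroup.m_closed[OF K 1 this] show ?thesis by simp
  qed
  \<comment> \<open>Both images are computed on representatives; they agree at each index by
    \<open>vanish\<close>. Injectivity then makes the two tensors equal.\<close>
  have "tensor_product_canonical_map R ?RS J Q (tensor_class R ?RS P (frag_of (v, e))) =
        tensor_product_canonical_map R ?RS J Q (tensor_class R ?RS P 0)"
    unfolding P_def
    using canonical_map_class[OF RSmod Qmod carr(1)[unfolded P_def]]
      canonical_map_class[OF RSmod Qmod carr(2)[unfolded P_def]]
  proof (simp, intro restrict_ext)
    fix C assume C: "C \<in> J"
    have "\<one>\<^bsub>Q C\<^esub> \<in> carrier (Q C)"
      using C by (auto simp: J_def Q_cyl one_coded_quotient_closed[OF R])
    then show "tensor_class R ?RS (Q C) (frag_of (v, e C)) = tensor_class R ?RS (Q C) 0"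
      using C v vanish[OF C] by (subst tensor_class_eq_iff[OF RSmod Qmod[OF C]]) (auto simp: e_def)
  qed
  moreover have "tensor_class R ?RS P c \<in> carrier (tensor_product R ?RS P)" if "c \<in> carrier ?F" for c
    using that by (auto simp: tensor_class_def tensor_product_def FactGroup_def RCOSETS_def)
  moreover have "inj_on (tensor_product_canonical_map R ?RS J Q) (carrier (tensor_product R ?RS P))"
    using inj Qmod by (simp add: mittag_leffler_def P_def)
  ultimately have "tensor_class R ?RS P (frag_of (v, e)) = tensor_class R ?RS P 0"
    using carr by (simp add: inj_on_eq_iff)
  then have "frag_of (v, e) \<in> tensor_kernel R ?RS P"
    using tensor_class_eq_iff[OF RSmod Pmod carr] by simp
  then obtain u where u: "u \<in> S" "u \<odot>\<^bsub>P\<^esub> e = \<zero>\<^bsub>P\<^esub>"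
    using frac_tensor_eq_zeroD[OF R S Pmod _ _ e, of "\<one>\<^bsub>R\<^esub>" "\<one>\<^bsub>R\<^esub>"] by (auto simp: v_def)
  have "u \<in> I" if I: "I \<in> \<I>" for I
  proof -
    have C: "cylinder I \<in> J" using I by (simp add: J_def)
    \<comment> \<open>The component at the index of \<open>I\<close> says that \<open>u\<close>
      annihilates the unit of \<open>R/I\<close>.\<close>
    have "(u \<odot>\<^bsub>P\<^esub> e) (cylinder I) = \<zero>\<^bsub>P\<^esub> (cylinder I)" by (simp add: u)
    then have "u \<odot>\<^bsub>coded_quotient R I\<^esub> \<one>\<^bsub>coded_quotient R I\<^esub> = \<zero>\<^bsub>coded_quotient R I\<^esub>"
      using C by (simp add: P_def product_module_def e_def Q_cyl)
    then show ?thesis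
      using smult_one_coded_quotient_eq_zero_iff[OF R ideals[OF I]] u by simp
  qed
  then show ?thesis using u by blast
qed

section \<open>Transporter ideals and localized submodules\<close>

text \<open>This is the ideal \<open>(N : x)\<close>, the preimage of \<open>N\<close> under the
  linear map sending \<open>r\<close> to \<open>r x\<close>. It turns a question about submodules
  into one about ideals meeting \<open>S\<close>.\<close>

lemma ideal_transporter:
  assumes "cring R" "module R L" "submodule N R L" "x \<in> carrier L"
  shows "ideal {r \<in> carrier R. r \<odot>\<^bsub>L\<^esub> x \<in> N} R"
proof -
  interpret R: cring R by fact
  interpret L: module R L by fact
  interpret N: submodule N R L by fact
  have mult: "b \<otimes>\<^bsub>R\<^esub> a \<in> {r \<in> carrier R. r \<odot>\<^bsub>L\<^esub> x \<in> N}"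
    if "a \<in> {r \<in> carrier R. r \<odot>\<^bsub>L\<^esub> x \<in> N}" "b \<in> carrier R" for a b
    using that assms(4) by (auto simp: L.smult_assoc1)
  show ?thesis
  proof (rule idealI)
    show "subgroup {r \<in> carrier R. r \<odot>\<^bsub>L\<^esub> x \<in> N} (add_monoid R)"
    proof (rule R.add.subgroupI)
      fix a b assume a: "a \<in> {r \<in> carrier R. r \<odot>\<^bsub>L\<^esub> x \<in> N}" and "b \<in> {r \<in> carrier R. r \<odot>\<^bsub>L\<^esub> x \<in> N}"
      then show "a \<oplus>\<^bsub>R\<^esub> b \<in> {r \<in> carrier R. r \<odot>\<^bsub>L\<^esub> x \<in> N}"
        using assms(4) N.m_closed by (auto simp: L.smult_l_distr)
      show "\<ominus>\<^bsub>R\<^esub> a \<in> {r \<in> carrier R. r \<odot>\<^bsub>L\<^esub> x \<in> N}"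
        using a assms(4) N.m_inv_closed by (auto simp: L.smult_l_minus simp flip: a_inv_def)
    qed (use assms(4) N.one_closed in \<open>auto intro!: exI[of _ "\<zero>\<^bsub>R\<^esub>"]\<close>)
    show "a \<otimes>\<^bsub>R\<^esub> b \<in> {r \<in> carrier R. r \<odot>\<^bsub>L\<^esub> x \<in> N}"
      if "a \<in> {r \<in> carrier R. r \<odot>\<^bsub>L\<^esub> x \<in> N}" "b \<in> carrier R" for a b
      using mult[OF that] that by (simp add: R.m_comm)
  qed (use mult in \<open>auto simp: R.ring_axioms\<close>)
qed

text \<open>The numerator \<open>x\<close> need not lie in \<open>N\<close>, but an equality
  \<open>x/s = y/t\<close> with \<open>y\<close> in \<open>N\<close> gives
  \<open>u t x = u s y\<close>, so the multiplier \<open>u t\<close> brings \<open>x\<close> into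
  \<open>N\<close>.\<close>

lemma loc_frac_in_localized_submoduleD:
  assumes "cring R" "multiplicative_set R S" "module R L" "submodule N R L"
    and "x \<in> carrier L" "s \<in> S" "loc_frac S L x s \<in> localized_submodule S L N"
  shows "\<exists>u\<in>S. u \<odot>\<^bsub>L\<^esub> x \<in> N"
proof -
  interpret S: submonoid S R using assms(2) by (simp add: multiplicative_set_def)
  interpret N: submodule N R L by fact
  obtain y t where y: "y \<in> N" "t \<in> S" "loc_frac S L x s = loc_frac S L y t"
    using assms(7) by (auto simp: localized_submodule_def)
  then obtain u where "u \<in> S" "(u \<otimes>\<^bsub>R\<^esub> t) \<odot>\<^bsub>L\<^esub> x = (u \<otimes>\<^bsub>R\<^esub> s) \<odot>\<^bsub>L\<^esub> y"
    using loc_frac_eq_iff[OF assms(1-3,5,6), of y t] N.subset by auto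
  then show ?thesis
    using y assms(6) by (auto intro!: bexI[of _ "u \<otimes>\<^bsub>R\<^esub> t"])
qed

section \<open>Intersections of localized submodules and of principal ideals\<close>

theorem corollary4p6:
  fixes R :: "('r, 'z) ring_scheme" and S :: "'r set"
  assumes "cring R" and "\<one>\<^bsub>R\<^esub> \<noteq> \<zero>\<^bsub>R\<^esub>"
    and "multiplicative_set R S"
    and "mittag_leffler TYPE((nat \<Rightarrow> 'r) set) TYPE((nat \<Rightarrow> 'r) set) R
           (localization R S (regular_module R))"
  shows "(\<forall>(L :: ('r, 'l) module) (\<Lambda> :: 'k set) (N :: 'k \<Rightarrow> 'l set).
            finitely_generated_module R L \<longrightarrow> (\<forall>k\<in>\<Lambda>. submodule (N k) R L) \<longrightarrow>
              localized_submodule S L (carrier L \<inter> (\<Inter>k\<in>\<Lambda>. N k)) =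
              carrier (localization R S L) \<inter> (\<Inter>k\<in>\<Lambda>. localized_submodule S L (N k)))
         \<and> strongly_multiplicative_set TYPE('d) R S"
proof (intro conjI allI impI)
  interpret R: cring R by fact
  interpret S: submonoid S R using assms(3) by (simp add: multiplicative_set_def)
  note meet = mittag_leffler_localization_ideals_meet[OF assms(1,3,4)]
  show "strongly_multiplicative_set TYPE('d) R S"
    unfolding strongly_multiplicative_set_def
  proof (intro conjI allI impI)
    fix \<Delta> :: "'d set" and s assume s: "s \<in> \<Delta> \<rightarrow> S"
    have sR: "s i \<in> carrier R" if "i \<in> \<Delta>" for i using funcset_mem[OF s that] by simp
    \<comment> \<open>Each principal ideal meets \<open>S\<close> in its own generator.\<close>
    have "\<exists>u\<in>S. \<forall>I\<in>(\<lambda>i. PIdl\<^bsub>R\<^esub> (s i)) ` \<Delta>. u \<in> I"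
      by (rule meet) (use s sR in \<open>auto intro!: R.cgenideal_ideal dest: R.cgenideal_self\<close>)
    then obtain u where "u \<in> S" "\<forall>i\<in>\<Delta>. u \<in> PIdl\<^bsub>R\<^esub> (s i)" by auto
    then have "u \<in> (carrier R \<inter> (\<Inter>i\<in>\<Delta>. PIdl\<^bsub>R\<^esub> (s i))) \<inter> S" by simp
    then show "(carrier R \<inter> (\<Inter>i\<in>\<Delta>. PIdl\<^bsub>R\<^esub> (s i))) \<inter> S \<noteq> {}" by blast
  qed (rule assms(3))
  fix L :: "('r, 'l) module" and \<Lambda> :: "'k set" and N :: "'k \<Rightarrow> 'l set"
  assume "finitely_generated_module R L" and N: "\<forall>k\<in>\<Lambda>. submodule (N k) R L"
  then have L: "module R L" by (simp add: finitely_generated_module_def)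
  interpret L: module R L by (rule L)
  show "localized_submodule S L (carrier L \<inter> (\<Inter>k\<in>\<Lambda>. N k)) =
      carrier (localization R S L) \<inter> (\<Inter>k\<in>\<Lambda>. localized_submodule S L (N k))"
  proof
    show "carrier (localization R S L) \<inter> (\<Inter>k\<in>\<Lambda>. localized_submodule S L (N k))
        \<subseteq> localized_submodule S L (carrier L \<inter> (\<Inter>k\<in>\<Lambda>. N k))"
    proof
      fix A assume A: "A \<in> carrier (localization R S L) \<inter> (\<Inter>k\<in>\<Lambda>. localized_submodule S L (N k))"
      then obtain x s where x: "x \<in> carrier L" "s \<in> S" "A = loc_frac S L x s"
        by (blast elim: localization_fracE)
      \<comment> \<open>Membership of \<open>x/s\<close> in each localized submodule makes each
        transporter ideal meet \<open>S\<close>; a common element \<open>u\<close> then serves all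
        \<open>k\<close> at once.\<close>
      have "\<exists>u\<in>S. \<forall>I\<in>(\<lambda>k. {r \<in> carrier R. r \<odot>\<^bsub>L\<^esub> x \<in> N k}) ` \<Lambda>. u \<in> I"
      proof (rule meet; elim imageE)
        fix I k assume k: "k \<in> \<Lambda>" and I: "I = {r \<in> carrier R. r \<odot>\<^bsub>L\<^esub> x \<in> N k}"
        show "ideal I R"
          unfolding I by (rule ideal_transporter[OF assms(1) L bspec[OF N k] x(1)])
        have "loc_frac S L x s \<in> localized_submodule S L (N k)"
          using A k x(3) by blast
        then obtain u where "u \<in> S" "u \<odot>\<^bsub>L\<^esub> x \<in> N k"
          using loc_frac_in_localized_submoduleD[OF assms(1,3) L bspec[OF N k] x(1,2)] by blast
        then show "I \<inter> S \<noteq> {}"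
          unfolding I using S.mem_carrier by blast
      qed
      then obtain u where u: "u \<in> S" "\<forall>k\<in>\<Lambda>. u \<odot>\<^bsub>L\<^esub> x \<in> N k" by auto
      \<comment> \<open>Expanding the fraction by \<open>u\<close> moves its numerator into every
        \<open>N k\<close>.\<close>
      have "A = loc_frac S L (u \<odot>\<^bsub>L\<^esub> x) (u \<otimes>\<^bsub>R\<^esub> s)"
        using x u(1) by (simp add: loc_frac_eq_iff[OF assms(1,3) L])
          (auto simp: R.m_ac simp flip: L.smult_assoc1 intro!: bexI[of _ "\<one>\<^bsub>R\<^esub>"])
      moreover have "(u \<odot>\<^bsub>L\<^esub> x, u \<otimes>\<^bsub>R\<^esub> s) \<in> (carrier L \<inter> (\<Inter>k\<in>\<Lambda>. N k)) \<times> S"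
        using x u by simp
      ultimately show "A \<in> localized_submodule S L (carrier L \<inter> (\<Inter>k\<in>\<Lambda>. N k))"
        unfolding localized_submodule_def by (metis (no_types, lifting) image_eqI case_prod_conv)
    qed
  qed (auto simp: carrier_localization localized_submodule_def)
qed

end
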